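(* Let $(R,r)$ be an epireflector and $\mathbb{T}=(T,\mu,\eta)$ a monad on a category $\mathbf{C}$. Suppose that $R\eta_X:RX\to RTX$ is an epimorphism in $R(\mathbf{C})$ for every object $X$ of $\mathbf{C}$. If for each $X\in\mathbf{C}$ the morphism $\eta_{RTX}:RTX\to TRTX$ is a split monomorphism, then for each $\mathbb{T}$-algebra $(X,a)$, the object $RX$ admits a $\mathbb{T}$-structure morphism $b:TRX\to RX$, i.e. $(RX,b)$ is a $\mathbb{T}$-algebra for some $b$.
   Context: A reflective subcategory of $\mathbf{C}$ is a full subcategory whose inclusion into $\mathbf{C}$ has a left adjoint $R$; with unit $r:1\to R$, the pair $(R,r)$ is called a reflector, the reflective subcategory is denoted $R(\mathbf{C})$, and $R$ is regarded as an endofunctor $R:\mathbf{C}\to\mathbf{C}$. $(R,r)$ is an epireflector if each $r_X:X\to RX$ is an epimorphism in $\mathbf{C}$. A monad $\mathbb{T}=(T,\mu,\eta)$ has multiplication $\mu:TT\to T$ and unit $\eta:1\to T$. A $\mathbb{T}$-algebra is a pair $(X,a)$ with $a:TX\to X$ (the structure morphism) satisfying $a\cdot Ta=a\cdot\mu_X$ and $a\cdot\eta_X=1_X$. *)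

theory Defs
  imports Main
begin

text \<open>Objects and arrows are sets inside arbitrary types; the operations are only
  constrained on these carriers.\<close>

record ('o, 'm) cat =
  Obj :: "'o set"
  Arr :: "'m set"
  Dom :: "'m \<Rightarrow> 'o"
  Cod :: "'m \<Rightarrow> 'o"
  Id :: "'o \<Rightarrow> 'm"
  Comp :: "'m \<Rightarrow> 'm \<Rightarrow> 'm"  (infixr "\<cdot>\<index>" 75)

definition hom :: "('o, 'm) cat \<Rightarrow> 'o \<Rightarrow> 'o \<Rightarrow> 'm set" where
  "hom C X Y = {f \<in> Arr C. Dom C f = X \<and> Cod C f = Y}"

locale category =
  fixes C :: "('o, 'm) cat" (structure)
  assumes Dom_in_Obj: "f \<in> Arr C \<Longrightarrow> Dom C f \<in> Obj C"
    and Cod_in_Obj: "f \<in> Arr C \<Longrightarrow> Cod C f \<in> Obj C"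
    and Id_in_hom: "X \<in> Obj C \<Longrightarrow> Id C X \<in> hom C X X"
    and Comp_in_hom: "\<lbrakk>f \<in> hom C X Y; g \<in> hom C Y Z\<rbrakk> \<Longrightarrow> g \<cdot> f \<in> hom C X Z"
    and Comp_Id: "f \<in> hom C X Y \<Longrightarrow> f \<cdot> Id C X = f"
    and Id_Comp: "f \<in> hom C X Y \<Longrightarrow> Id C Y \<cdot> f = f"
    and Comp_assoc: "\<lbrakk>f \<in> hom C W X; g \<in> hom C X Y; h \<in> hom C Y Z\<rbrakk>
      \<Longrightarrow> (h \<cdot> g) \<cdot> f = h \<cdot> (g \<cdot> f)"

definition epimorphism :: "('o, 'm) cat \<Rightarrow> 'm \<Rightarrow> bool" where
  "epimorphism C e \<longleftrightarrow> e \<in> Arr C \<and>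
    (\<forall>Z. \<forall>g \<in> hom C (Cod C e) Z. \<forall>h \<in> hom C (Cod C e) Z.
      g \<cdot>\<^bsub>C\<^esub> e = h \<cdot>\<^bsub>C\<^esub> e \<longrightarrow> g = h)"

definition split_monomorphism :: "('o, 'm) cat \<Rightarrow> 'm \<Rightarrow> bool" where
  "split_monomorphism C m \<longleftrightarrow> m \<in> Arr C \<and>
    (\<exists>s \<in> hom C (Cod C m) (Dom C m). s \<cdot>\<^bsub>C\<^esub> m = Id C (Dom C m))"

definition full_subcategory :: "('o, 'm) cat \<Rightarrow> 'o set \<Rightarrow> ('o, 'm) cat" where
  "full_subcategory C S =
    C\<lparr>Obj := S, Arr := {f \<in> Arr C. Dom C f \<in> S \<and> Cod C f \<in> S}\<rparr>"

record ('o1, 'm1, 'o2, 'm2) fnctr =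
  ob :: "'o1 \<Rightarrow> 'o2"
  ar :: "'m1 \<Rightarrow> 'm2"

locale is_functor = A: category A + B: category B
  for A :: "('o1, 'm1) cat" and B :: "('o2, 'm2) cat" +
  fixes F :: "('o1, 'm1, 'o2, 'm2) fnctr"
  assumes ob_in_Obj: "X \<in> Obj A \<Longrightarrow> ob F X \<in> Obj B"
    and ar_in_hom: "f \<in> hom A X Y \<Longrightarrow> ar F f \<in> hom B (ob F X) (ob F Y)"
    and ar_Id: "X \<in> Obj A \<Longrightarrow> ar F (Id A X) = Id B (ob F X)"
    and ar_Comp: "\<lbrakk>f \<in> hom A X Y; g \<in> hom A Y Z\<rbrakk>
      \<Longrightarrow> ar F (g \<cdot>\<^bsub>A\<^esub> f) = ar F g \<cdot>\<^bsub>B\<^esub> ar F f"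

definition id_functor :: "('o, 'm, 'o, 'm) fnctr" where
  "id_functor = \<lparr>ob = (\<lambda>X. X), ar = (\<lambda>f. f)\<rparr>"

definition comp_functor ::
  "('o2, 'm2, 'o3, 'm3) fnctr \<Rightarrow> ('o1, 'm1, 'o2, 'm2) fnctr \<Rightarrow> ('o1, 'm1, 'o3, 'm3) fnctr"
  (infixl "\<circ>\<^sub>F" 70) where
  "G \<circ>\<^sub>F F = \<lparr>ob = (\<lambda>X. ob G (ob F X)), ar = (\<lambda>f. ar G (ar F f))\<rparr>"

locale natural_transformation =
  F: is_functor A B F + G: is_functor A B G
  for A :: "('o1, 'm1) cat" and B :: "('o2, 'm2) cat"
    and F G :: "('o1, 'm1, 'o2, 'm2) fnctr" +
  fixes \<tau> :: "'o1 \<Rightarrow> 'm2"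
  assumes component: "X \<in> Obj A \<Longrightarrow> \<tau> X \<in> hom B (ob F X) (ob G X)"
    and naturality: "f \<in> hom A X Y \<Longrightarrow> \<tau> Y \<cdot>\<^bsub>B\<^esub> ar F f = ar G f \<cdot>\<^bsub>B\<^esub> \<tau> X"

locale adjunction =
  left: is_functor A B F +
  right: is_functor B A G +
  unit: natural_transformation A A id_functor "G \<circ>\<^sub>F F" \<eta> +
  counit: natural_transformation B B "F \<circ>\<^sub>F G" id_functor \<epsilon>
  for A :: "('o1, 'm1) cat" and B :: "('o2, 'm2) cat"
    and F :: "('o1, 'm1, 'o2, 'm2) fnctr" and G :: "('o2, 'm2, 'o1, 'm1) fnctr"
    and \<eta> :: "'o1 \<Rightarrow> 'm1" and \<epsilon> :: "'o2 \<Rightarrow> 'm2" +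
  assumes triangle_left:
      "X \<in> Obj A \<Longrightarrow> \<epsilon> (ob F X) \<cdot>\<^bsub>B\<^esub> ar F (\<eta> X) = Id B (ob F X)"
    and triangle_right:
      "Y \<in> Obj B \<Longrightarrow> ar G (\<epsilon> Y) \<cdot>\<^bsub>A\<^esub> \<eta> (ob G Y) = Id A (ob G Y)"

text \<open>The inclusion of a full subcategory acts as \<^const>\<open>id_functor\<close>, so the left adjoint
  \<open>R\<close> and the endofunctor of \<open>C\<close> it induces are the same pair of maps. The set \<open>S\<close> consists
  of the objects of \<open>R(C)\<close>; it is a parameter because \<open>R\<close> determines it only up to
  isomorphism of objects (\<open>S\<close> need not be closed under isomorphism).\<close>

definition reflector ::
  "('o, 'm) cat \<Rightarrow> 'o set \<Rightarrow> ('o, 'm, 'o, 'm) fnctr \<Rightarrow> ('o \<Rightarrow> 'm) \<Rightarrow> bool" where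
  "reflector C S R r \<longleftrightarrow> category C \<and> S \<subseteq> Obj C \<and>
    (\<exists>\<epsilon>. adjunction C (full_subcategory C S) R id_functor r \<epsilon>)"

definition epireflector ::
  "('o, 'm) cat \<Rightarrow> 'o set \<Rightarrow> ('o, 'm, 'o, 'm) fnctr \<Rightarrow> ('o \<Rightarrow> 'm) \<Rightarrow> bool" where
  "epireflector C S R r \<longleftrightarrow> reflector C S R r \<and> (\<forall>X \<in> Obj C. epimorphism C (r X))"

locale monad =
  endo: is_functor C C T +
  mult: natural_transformation C C "T \<circ>\<^sub>F T" T \<mu> +
  unit: natural_transformation C C id_functor T \<eta>
  for C :: "('o, 'm) cat" (structure)
    and T :: "('o, 'm, 'o, 'm) fnctr" and \<mu> \<eta> :: "'o \<Rightarrow> 'm" +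
  assumes assoc: "X \<in> Obj C \<Longrightarrow> \<mu> X \<cdot> ar T (\<mu> X) = \<mu> X \<cdot> \<mu> (ob T X)"
    and unit_left: "X \<in> Obj C \<Longrightarrow> \<mu> X \<cdot> \<eta> (ob T X) = Id C (ob T X)"
    and unit_right: "X \<in> Obj C \<Longrightarrow> \<mu> X \<cdot> ar T (\<eta> X) = Id C (ob T X)"

locale monad_algebra = monad C T \<mu> \<eta>
  for C :: "('o, 'm) cat" (structure)
    and T :: "('o, 'm, 'o, 'm) fnctr" and \<mu> \<eta> :: "'o \<Rightarrow> 'm" +
  fixes X :: 'o and a :: 'm
  assumes carrier: "X \<in> Obj C"
    and struct_map: "a \<in> hom C (ob T X) X"
    and struct_assoc: "a \<cdot> ar T a = a \<cdot> \<mu> X"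
    and struct_unit: "a \<cdot> \<eta> X = Id C X"

lemma category_full_subcategory:
  assumes "category C" and "S \<subseteq> Obj C"
  shows "category (full_subcategory C S)"
proof -
  interpret category C by fact
  show ?thesis
    using assms(2) Id_in_hom Comp_in_hom Comp_Id Id_Comp Comp_assoc
    by unfold_locales (auto simp: full_subcategory_def hom_def subset_iff)
qed

lemma is_functor_inclusion:
  assumes "category C" and "S \<subseteq> Obj C"
  shows "is_functor (full_subcategory C S) C id_functor"
  using assms category_full_subcategory[OF assms]
  by (auto simp: is_functor_def is_functor_axioms_def full_subcategory_def id_functor_def hom_def)

end

theory Submission imports Defs begin

text \<open>
  Every morphism \<open>f : TZ \<rightarrow> Y\<close> into an object of \<open>R(C)\<close> is determined by \<open>f \<cdot> \<eta>\<^sub>Z\<close>: it factors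
  through \<open>r\<^sub>T\<^sub>Z\<close>, and \<open>r\<^sub>T\<^sub>Z \<cdot> \<eta>\<^sub>Z = R\<eta>\<^sub>Z \<cdot> r\<^sub>Z\<close> is an epimorphism followed by one that can be
  cancelled in \<open>R(C)\<close> (lemma \<open>cancel_unit_into_reflective\<close>). For an object \<open>Y\<close> with this property,
  the unit law alone makes \<open>b : TY \<rightarrow> Y\<close> a structure morphism, because the two sides of the
  associativity law both become \<open>b\<close> after composition with \<open>\<eta>\<^sub>T\<^sub>Y\<close>
  (lemma \<open>monad_algebra_of_unit_retraction\<close>).

  It remains to find a retraction of \<open>\<eta>\<^sub>R\<^sub>X\<close>. Since \<open>a \<cdot> \<eta>\<^sub>X = 1\<close>, the object \<open>RX\<close> is a retract of
  \<open>RTX\<close> by means of \<open>R\<eta>\<^sub>X\<close> and \<open>Ra\<close>, and by naturality of \<open>\<eta>\<close> a retraction of the unit at \<open>RTX\<close>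
  passes to every retract of \<open>RTX\<close> (lemma \<open>unit_retraction_of_retract\<close>). Explicitly, if \<open>s\<close> is a
  retraction of the unit at \<open>RTX\<close>, then \<open>b = Ra \<cdot> s \<cdot> TR\<eta>\<^sub>X\<close>.
\<close>

lemma reflector_extension:
  assumes "reflector C S R r" and "f \<in> hom C Z Y" and "Y \<in> S"
  obtains f' where "f' \<in> hom C (ob R Z) Y" and "f' \<cdot>\<^bsub>C\<^esub> r Z = f"
proof -
  obtain \<epsilon> where adj: "adjunction C (full_subcategory C S) R id_functor r \<epsilon>"
    using assms(1) unfolding reflector_def by blast
  interpret adjunction C "full_subcategory C S" R id_functor r \<epsilon> by (fact adj)
  have Z: "Z \<in> Obj C" and Y: "Y \<in> Obj C"
    using assms(2) left.A.Dom_in_Obj left.A.Cod_in_Obj unfolding hom_def by auto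
  have eps: "\<epsilon> Y \<in> hom C (ob R Y) Y"
    using counit.component[of Y] \<open>Y \<in> S\<close>
    by (simp add: full_subcategory_def hom_def id_functor_def comp_functor_def)
  have Rf: "ar R f \<in> hom C (ob R Z) (ob R Y)"
    using left.ar_in_hom[OF assms(2)] by (simp add: full_subcategory_def hom_def)
  have rZ: "r Z \<in> hom C Z (ob R Z)" and rY: "r Y \<in> hom C Y (ob R Y)"
    using unit.component[OF Z] unit.component[OF Y] by (auto simp: id_functor_def comp_functor_def)
  have tri: "\<epsilon> Y \<cdot>\<^bsub>C\<^esub> r Y = Id C Y"
    using triangle_right[of Y] \<open>Y \<in> S\<close> by (simp add: full_subcategory_def id_functor_def)
  have "(\<epsilon> Y \<cdot>\<^bsub>C\<^esub> ar R f) \<cdot>\<^bsub>C\<^esub> r Z = \<epsilon> Y \<cdot>\<^bsub>C\<^esub> (ar R f \<cdot>\<^bsub>C\<^esub> r Z)"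
    by (rule left.A.Comp_assoc[OF rZ Rf eps])
  also have "\<dots> = \<epsilon> Y \<cdot>\<^bsub>C\<^esub> (r Y \<cdot>\<^bsub>C\<^esub> f)"
    using unit.naturality[OF assms(2)] by (simp add: id_functor_def comp_functor_def)
  also have "\<dots> = (\<epsilon> Y \<cdot>\<^bsub>C\<^esub> r Y) \<cdot>\<^bsub>C\<^esub> f"
    by (rule left.A.Comp_assoc[OF assms(2) rY eps, symmetric])
  also have "\<dots> = f"
    using left.A.Id_Comp[OF assms(2)] tri by simp
  finally show thesis
    using that left.A.Comp_in_hom[OF Rf eps] by blast
qed

text \<open>Naturality of \<open>r\<close> turns restriction along \<open>e\<close> into restriction along \<open>Re\<close> of the extensions
  to the reflections; these extensions are morphisms of \<open>R(C)\<close>, so it is enough that \<open>Re\<close> is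
  epi there.\<close>

lemma cancel_unit_into_reflective:
  assumes epi: "epireflector C S R r" and e: "e \<in> hom C Z W"
    and Re: "epimorphism (full_subcategory C S) (ar R e)"
    and f: "f \<in> hom C W Y" and g: "g \<in> hom C W Y" and Y: "Y \<in> S"
    and eq: "f \<cdot>\<^bsub>C\<^esub> e = g \<cdot>\<^bsub>C\<^esub> e"
  shows "f = g"
proof -
  have refl: "reflector C S R r" and r_epi: "\<And>X. X \<in> Obj C \<Longrightarrow> epimorphism C (r X)"
    using epi unfolding epireflector_def by auto
  obtain \<epsilon> where adj: "adjunction C (full_subcategory C S) R id_functor r \<epsilon>"
    using refl unfolding reflector_def by blast
  interpret adjunction C "full_subcategory C S" R id_functor r \<epsilon> by (fact adj)
  obtain f' where f': "f' \<in> hom C (ob R W) Y" and ff: "f' \<cdot>\<^bsub>C\<^esub> r W = f"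
    using reflector_extension[OF refl f Y] by blast
  obtain g' where g': "g' \<in> hom C (ob R W) Y" and gg: "g' \<cdot>\<^bsub>C\<^esub> r W = g"
    using reflector_extension[OF refl g Y] by blast
  have Z: "Z \<in> Obj C" and W: "W \<in> Obj C"
    using e left.A.Dom_in_Obj left.A.Cod_in_Obj unfolding hom_def by auto
  have rZ: "r Z \<in> hom C Z (ob R Z)" and rW: "r W \<in> hom C W (ob R W)"
    using unit.component[OF Z] unit.component[OF W] by (auto simp: id_functor_def comp_functor_def)
  have nat: "r W \<cdot>\<^bsub>C\<^esub> e = ar R e \<cdot>\<^bsub>C\<^esub> r Z"
    using unit.naturality[OF e] by (simp add: id_functor_def comp_functor_def)
  have Re_sub: "ar R e \<in> hom (full_subcategory C S) (ob R Z) (ob R W)"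
    by (rule left.ar_in_hom[OF e])
  then have Re_hom: "ar R e \<in> hom C (ob R Z) (ob R W)" and RW: "ob R W \<in> S"
    by (auto simp: full_subcategory_def hom_def)
  have slide: "(h \<cdot>\<^bsub>C\<^esub> r W) \<cdot>\<^bsub>C\<^esub> e = (h \<cdot>\<^bsub>C\<^esub> ar R e) \<cdot>\<^bsub>C\<^esub> r Z"
    if "h \<in> hom C (ob R W) Y" for h
    using left.A.Comp_assoc[OF e rW that] left.A.Comp_assoc[OF rZ Re_hom that] nat by simp
  have "(f' \<cdot>\<^bsub>C\<^esub> ar R e) \<cdot>\<^bsub>C\<^esub> r Z = (g' \<cdot>\<^bsub>C\<^esub> ar R e) \<cdot>\<^bsub>C\<^esub> r Z"
    using slide[OF f'] slide[OF g'] ff gg eq by simp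
  then have "f' \<cdot>\<^bsub>C\<^esub> ar R e = g' \<cdot>\<^bsub>C\<^esub> ar R e"
    using r_epi[OF Z] rZ left.A.Comp_in_hom[OF Re_hom f'] left.A.Comp_in_hom[OF Re_hom g']
    unfolding epimorphism_def by (auto simp: hom_def)
  moreover have "f' \<in> hom (full_subcategory C S) (ob R W) Y"
    and "g' \<in> hom (full_subcategory C S) (ob R W) Y"
    using f' g' RW Y by (auto simp: full_subcategory_def hom_def)
  ultimately have "f' = g'"
    using Re Re_sub unfolding epimorphism_def by (auto simp: full_subcategory_def hom_def)
  then show ?thesis using ff gg by simp
qed

text \<open>Naturality of \<open>\<eta>\<close> gives \<open>b \<cdot> Tb \<cdot> \<eta>\<^sub>T\<^sub>Y = b \<cdot> \<eta>\<^sub>Y \<cdot> b = b\<close>, and the unit law of the monad gives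
  \<open>b \<cdot> \<mu>\<^sub>Y \<cdot> \<eta>\<^sub>T\<^sub>Y = b\<close>; the hypothesis \<open>cancel\<close> removes \<open>\<eta>\<^sub>T\<^sub>Y\<close>.\<close>

lemma monad_algebra_of_unit_retraction:
  assumes "monad C T \<mu> \<eta>" and Y: "Y \<in> Obj C"
    and b: "b \<in> hom C (ob T Y) Y" and b_unit: "b \<cdot>\<^bsub>C\<^esub> \<eta> Y = Id C Y"
    and cancel: "\<And>f g. \<lbrakk>f \<in> hom C (ob T (ob T Y)) Y; g \<in> hom C (ob T (ob T Y)) Y;
      f \<cdot>\<^bsub>C\<^esub> \<eta> (ob T Y) = g \<cdot>\<^bsub>C\<^esub> \<eta> (ob T Y)\<rbrakk> \<Longrightarrow> f = g"
  shows "monad_algebra C T \<mu> \<eta> Y b"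
proof -
  interpret monad C T \<mu> \<eta> by fact
  have TY: "ob T Y \<in> Obj C" using endo.ob_in_Obj[OF Y] .
  have Tb: "ar T b \<in> hom C (ob T (ob T Y)) (ob T Y)" using endo.ar_in_hom[OF b] .
  have \<mu>Y: "\<mu> Y \<in> hom C (ob T (ob T Y)) (ob T Y)"
    using mult.component[OF Y] by (simp add: comp_functor_def)
  have \<eta>Y: "\<eta> Y \<in> hom C Y (ob T Y)" and \<eta>TY: "\<eta> (ob T Y) \<in> hom C (ob T Y) (ob T (ob T Y))"
    using unit.component[OF Y] unit.component[OF TY] by (auto simp: id_functor_def)
  have nat: "ar T b \<cdot>\<^bsub>C\<^esub> \<eta> (ob T Y) = \<eta> Y \<cdot>\<^bsub>C\<^esub> b"
    using unit.naturality[OF b] by (simp add: id_functor_def)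
  have "(b \<cdot>\<^bsub>C\<^esub> ar T b) \<cdot>\<^bsub>C\<^esub> \<eta> (ob T Y) = b"
    using endo.A.Comp_assoc[OF \<eta>TY Tb b] endo.A.Comp_assoc[OF b \<eta>Y b] nat b_unit
      endo.A.Id_Comp[OF b] by simp
  moreover have "(b \<cdot>\<^bsub>C\<^esub> \<mu> Y) \<cdot>\<^bsub>C\<^esub> \<eta> (ob T Y) = b"
    using endo.A.Comp_assoc[OF \<eta>TY \<mu>Y b] unit_left[OF Y] endo.A.Comp_Id[OF b] by simp
  ultimately have "b \<cdot>\<^bsub>C\<^esub> ar T b = b \<cdot>\<^bsub>C\<^esub> \<mu> Y"
    using cancel endo.A.Comp_in_hom[OF Tb b] endo.A.Comp_in_hom[OF \<mu>Y b] by simp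
  then show ?thesis
    using Y b b_unit by unfold_locales
qed

lemma unit_retraction_of_retract:
  assumes "category C" and "natural_transformation C C id_functor T \<eta>"
    and i: "i \<in> hom C Y W" and p: "p \<in> hom C W Y" and pi: "p \<cdot>\<^bsub>C\<^esub> i = Id C Y"
    and s: "s \<in> hom C (ob T W) W" and s_unit: "s \<cdot>\<^bsub>C\<^esub> \<eta> W = Id C W"
  obtains b where "b \<in> hom C (ob T Y) Y" and "b \<cdot>\<^bsub>C\<^esub> \<eta> Y = Id C Y"
proof -
  interpret natural_transformation C C id_functor T \<eta> by fact
  have Y: "Y \<in> Obj C" and W: "W \<in> Obj C"
    using i F.A.Dom_in_Obj F.A.Cod_in_Obj unfolding hom_def by auto
  have \<eta>Y: "\<eta> Y \<in> hom C Y (ob T Y)" and \<eta>W: "\<eta> W \<in> hom C W (ob T W)"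
    using component[OF Y] component[OF W] by (auto simp: id_functor_def)
  have Ti: "ar T i \<in> hom C (ob T Y) (ob T W)" using G.ar_in_hom[OF i] .
  have sTi: "s \<cdot>\<^bsub>C\<^esub> ar T i \<in> hom C (ob T Y) W" using F.A.Comp_in_hom[OF Ti s] .
  have nat: "ar T i \<cdot>\<^bsub>C\<^esub> \<eta> Y = \<eta> W \<cdot>\<^bsub>C\<^esub> i"
    using naturality[OF i] by (simp add: id_functor_def)
  have "(s \<cdot>\<^bsub>C\<^esub> ar T i) \<cdot>\<^bsub>C\<^esub> \<eta> Y = i"
    using F.A.Comp_assoc[OF \<eta>Y Ti s] F.A.Comp_assoc[OF i \<eta>W s] nat s_unit F.A.Id_Comp[OF i]
    by simp
  then have "(p \<cdot>\<^bsub>C\<^esub> (s \<cdot>\<^bsub>C\<^esub> ar T i)) \<cdot>\<^bsub>C\<^esub> \<eta> Y = Id C Y"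
    using F.A.Comp_assoc[OF \<eta>Y sTi p] pi by simp
  then show thesis
    using that F.A.Comp_in_hom[OF sTi p] by blast
qed

theorem theorem20:
  fixes C :: "('o, 'm) cat" and S :: "'o set"
    and R T :: "('o, 'm, 'o, 'm) fnctr" and r \<mu> \<eta> :: "'o \<Rightarrow> 'm"
  assumes "category C"
    and "epireflector C S R r"
    and "monad C T \<mu> \<eta>"
    and "\<And>X. X \<in> Obj C \<Longrightarrow> epimorphism (full_subcategory C S) (ar R (\<eta> X))"
    and "\<And>X. X \<in> Obj C \<Longrightarrow> split_monomorphism C (\<eta> (ob R (ob T X)))"
  shows "\<And>X a. monad_algebra C T \<mu> \<eta> X a \<Longrightarrow> \<exists>b. monad_algebra C T \<mu> \<eta> (ob R X) b"
proof -
  fix X a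
  assume alg: "monad_algebra C T \<mu> \<eta> X a"
  interpret monad_algebra C T \<mu> \<eta> X a by (fact alg)
  obtain \<epsilon> where adj: "adjunction C (full_subcategory C S) R id_functor r \<epsilon>"
    using assms(2) unfolding epireflector_def reflector_def by blast
  interpret R: adjunction C "full_subcategory C S" R id_functor r \<epsilon> by (fact adj)
  have S: "S \<subseteq> Obj C" using assms(2) unfolding epireflector_def reflector_def by blast
  have R_obj: "ob R Z \<in> S" if "Z \<in> Obj C" for Z
    using R.left.ob_in_Obj[OF that] by (simp add: full_subcategory_def)
  have R_hom: "ar R f \<in> hom C (ob R Z) (ob R W)" if "f \<in> hom C Z W" for f Z W
    using R.left.ar_in_hom[OF that] by (simp add: full_subcategory_def hom_def)
  have \<eta>_hom: "\<eta> Z \<in> hom C Z (ob T Z)" if "Z \<in> Obj C" for Z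
    using unit.component[OF that] by (simp add: id_functor_def)
  have RX: "ob R X \<in> S" "ob R X \<in> Obj C" using R_obj[OF carrier] S by auto
  have TRX: "ob T (ob R X) \<in> Obj C" using endo.ob_in_Obj[OF RX(2)] .
  have RTX: "ob R (ob T X) \<in> Obj C" using R_obj[OF endo.ob_in_Obj[OF carrier]] S by auto
  have retract: "ar R a \<cdot>\<^bsub>C\<^esub> ar R (\<eta> X) = Id C (ob R X)"
    using R.left.ar_Comp[OF \<eta>_hom[OF carrier] struct_map] struct_unit R.left.ar_Id[OF carrier]
    by (simp add: full_subcategory_def)
  obtain s where "s \<in> hom C (ob T (ob R (ob T X))) (ob R (ob T X))"
    and "s \<cdot>\<^bsub>C\<^esub> \<eta> (ob R (ob T X)) = Id C (ob R (ob T X))"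
    using assms(5)[OF carrier] \<eta>_hom[OF RTX] unfolding split_monomorphism_def by (auto simp: hom_def)
  then obtain b where "b \<in> hom C (ob T (ob R X)) (ob R X)"
    and "b \<cdot>\<^bsub>C\<^esub> \<eta> (ob R X) = Id C (ob R X)"
    using unit_retraction_of_retract[OF assms(1) unit.natural_transformation_axioms
        R_hom[OF \<eta>_hom[OF carrier]] R_hom[OF struct_map] retract] by blast
  then have "monad_algebra C T \<mu> \<eta> (ob R X) b"
    using monad_algebra_of_unit_retraction[OF assms(3) RX(2)]
      cancel_unit_into_reflective[OF assms(2) \<eta>_hom[OF TRX] assms(4)[OF TRX] _ _ RX(1)]
    by blast
  then show "\<exists>b. monad_algebra C T \<mu> \<eta> (ob R X) b" ..
qed

end
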